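(* Let $n\geqslant0$, $m\geqslant1$, let $n\text{-}J_m$ be the $n$-multiplihedron and $[n\text{-}J_m]$ its unique top dimensional (i.e. $(n+m-1)$-dimensional) cell. The boundary of the cell $[n\text{-}J_m]$ is given by $$\partial^{sing}[n\text{-}J_m]\ \cup\bigcup_{h+k=m+1,\ 1\leqslant i\leqslant k,\ h\geqslant 2}[n\text{-}J_k]\times_i[K_h]\ \cup\bigcup_{i_1+\dots+i_s=m,\ I_1\cup\dots\cup I_s=\Delta^n,\ s\geqslant 2}[K_s]\times[\dim(I_1)\text{-}J_{i_1}]\times\cdots\times[\dim(I_s)\text{-}J_{i_s}],$$ where $I_1\cup\dots\cup I_s=\Delta^n$ runs over the overlapping partitions of $\Delta^n$.
   Context: $K_m$ ($m\geqslant2$) is the associahedron of dimension $m-2$, and $J_m$ ($m\geqslant1$) is the multiplihedron of dimension $m-1$. The codimension $i$ faces of $J_m$ are labeled by the broken two-colored trees obtained by blowing-up $i$ times the two-colored $m$-corolla: planar rooted trees of arity $m$ whose vertices are blue corollas (arity $\geqslant2$), two-colored corollas (arity $\geqslant1$, called the unbroken two-colored trees of the label) and red corollas (arity $\geqslant2$), such that every path from a leaf to the root meets exactly one two-colored corolla, with only blue corollas above it and only red corollas below it. The face labeled by such a tree is the product of the $K_h$ for its blue and red corollas of arity $h$ and the $J_k$ for its two-colored corollas of arity $k$. In particular the codimension one faces of $J_m$ are the $J_k\times_iK_h$ (a blue $h$-corolla grafted on the $i$-th input of the two-colored $k$-corolla, $h+k=m+1$, $1\leqslant i\leqslant k$,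 $h\geqslant2$) and the $K_s\times J_{i_1}\times\cdots\times J_{i_s}$ (two-colored corollas grafted on a red $s$-corolla, $i_1+\dots+i_s=m$, $s\geqslant2$). $\Delta^n=\{(z_1,\dots,z_n)\in\mathbb R^n\mid1\geqslant z_1\geqslant\cdots\geqslant z_n\geqslant0\}$, with vertices $0,\dots,n$, the vertex $k$ being the point with $k$ entries $1$ followed by $n-k$ entries $0$. For a sequence $\pmb a=(1>a_1>\cdots>a_{r}>0)$ (possibly empty), $\Delta^n_{\pmb a}$ denotes $\Delta^n$ subdivided by all hyperplanes $z_i=a_k$. Its top dimensional cells $\{z_{i_k}\geqslant a_k\geqslant z_{i_k+1},\ 1\leqslant k\leqslant r\}$, $0\leqslant i_1\leqslant\dots\leqslant i_r\leqslant n$, are labeled by the overlapping partitions $[0<\dots<i_1]\cup[i_1<\dots<i_2]\cup\cdots\cup[i_r<\dots<n]=\Delta^n$, and the cell labeled by $I_1\cup\dots\cup I_{r+1}$ is isomorphic to $I_1\times\dots\times I_{r+1}$. An overlapping partition of $\Delta^n$ is a sequence of faces $I_1,\dots,I_s$ with union $\Delta^n$ and $\max(I_\ell)=\min(I_{\ell+1})$ for $1\le \ell<s$. The $n$-multiplihedron $n\text{-}J_m$ is the polytope $\Delta^n\times J_m$ with the following refined subdivision: for each face $F$ of $J_m$ whose label contains exactly $s$ unbroken two-colored trees, ordered from left to right, with $i_r$ leaves of the whole tree located above the $r$-th one ($i_1+\dots+i_s=m$), $\Delta^n\times F$ is subdivided as $\Delta^n_{\pmb a}\times F$ with $\pmb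 a=\left(\frac{i_1+\dots+i_{s-1}}m>\frac{i_1+\dots+i_{s-2}}m>\dots>\frac{i_1}m\right)$. Notation for cells: $\partial^{sing}[n\text{-}J_m]$ is the union of the cells $I\times J_m$ for $I$ a codimension one face of $\Delta^n$; $[n\text{-}J_k]\times_i[K_h]$ is the cell $\Delta^n\times(J_k\times_iK_h)$; and $[K_s]\times[\dim(I_1)\text{-}J_{i_1}]\times\cdots\times[\dim(I_s)\text{-}J_{i_s}]$ is the cell of $\Delta^n_{\pmb a}\times(K_s\times J_{i_1}\times\cdots\times J_{i_s})$ given by the product of the top dimensional cell of $\Delta^n_{\pmb a}$ labeled by $I_1\cup\dots\cup I_s=\Delta^n$ with the face $K_s\times J_{i_1}\times\cdots\times J_{i_s}$ of $J_m$. *)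

theory Defs
  imports "HOL-Analysis.Analysis"
begin

section \<open>Broken two-colored trees\<close>

text \<open>
  The two types encode the coloring rule: every path from a leaf to the root of a
  \<open>broken_tree\<close> meets exactly one \<open>TwoColored\<close> vertex, with only \<open>Blue\<close> vertices above it and
  only \<open>Red\<close> vertices below it. A vertex carries the list of its inputs from left to right.
\<close>

datatype blue_tree = Leaf | Blue "blue_tree list"

datatype broken_tree = TwoColored "blue_tree list" | Red "broken_tree list"

primrec blue_leaves :: "blue_tree \<Rightarrow> nat" where
  "blue_leaves Leaf = 1"
| "blue_leaves (Blue ts) = sum_list (map blue_leaves ts)"

text \<open>The numbers of leaves located above the unbroken two-colored trees, from left to right.\<close>

primrec leaves_above :: "broken_tree \<Rightarrow> nat list" where
  "leaves_above (TwoColored ts) = [sum_list (map blue_leaves ts)]"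
| "leaves_above (Red ts) = concat (map leaves_above ts)"

text \<open>
  Blowing up a vertex once replaces it by a two-level tree: a blue (red) corolla by two blue (red)
  corollas of arity at least 2, a two-colored corolla either by a two-colored corolla with one
  blue corolla of arity at least 2 grafted on it, or by a red corolla of arity at least 2 with
  two-colored corollas of arity at least 1 grafted on all of its inputs.
\<close>

inductive blue_blow_up :: "blue_tree \<Rightarrow> blue_tree \<Rightarrow> bool" where
  blue_split: "2 \<le> length ys \<Longrightarrow> xs @ zs \<noteq> [] \<Longrightarrow>
    blue_blow_up (Blue (xs @ ys @ zs)) (Blue (xs @ [Blue ys] @ zs))"
| blue_subtree: "blue_blow_up t t' \<Longrightarrow>
    blue_blow_up (Blue (xs @ [t] @ zs)) (Blue (xs @ [t'] @ zs))"

inductive blow_up :: "broken_tree \<Rightarrow> broken_tree \<Rightarrow> bool" where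
  two_colored_above: "2 \<le> length ys \<Longrightarrow>
    blow_up (TwoColored (xs @ ys @ zs)) (TwoColored (xs @ [Blue ys] @ zs))"
| two_colored_below: "2 \<le> length yss \<Longrightarrow> (\<forall>ys\<in>set yss. ys \<noteq> []) \<Longrightarrow>
    blow_up (TwoColored (concat yss)) (Red (map TwoColored yss))"
| two_colored_subtree: "blue_blow_up t t' \<Longrightarrow>
    blow_up (TwoColored (xs @ [t] @ zs)) (TwoColored (xs @ [t'] @ zs))"
| red_split: "2 \<le> length ys \<Longrightarrow> xs @ zs \<noteq> [] \<Longrightarrow>
    blow_up (Red (xs @ ys @ zs)) (Red (xs @ [Red ys] @ zs))"
| red_subtree: "blow_up t t' \<Longrightarrow>
    blow_up (Red (xs @ [t] @ zs)) (Red (xs @ [t'] @ zs))"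

definition corolla :: "nat \<Rightarrow> broken_tree" where
  "corolla m = TwoColored (replicate m Leaf)"

definition broken_trees :: "nat \<Rightarrow> broken_tree set" where
  "broken_trees m = {t. blow_up\<^sup>*\<^sup>* (corolla m) t}"

text \<open>The labels of the faces \<open>J\<^sub>k \<times>\<^sub>i K\<^sub>h\<close> and \<open>K\<^sub>s \<times> J\<^bsub>i\<^sub>1\<^esub> \<times> \<dots> \<times> J\<^bsub>i\<^sub>s\<^esub>\<close>.\<close>

definition label_JK :: "nat \<Rightarrow> nat \<Rightarrow> nat \<Rightarrow> broken_tree" where
  "label_JK k i h =
     TwoColored (replicate (i - 1) Leaf @ [Blue (replicate h Leaf)] @ replicate (k - i) Leaf)"

definition label_KJ :: "nat list \<Rightarrow> broken_tree" where
  "label_KJ js = Red (map corolla js)"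


section \<open>The multiplihedron\<close>

text \<open>
  \<open>J\<close> is a realization of the multiplihedron \<open>J\<^sub>m\<close>, and \<open>\<phi>\<close> sends a broken two-colored tree to the
  face of \<open>J\<close> it labels. The labeling is required to be an isomorphism of posets, so \<open>J\<close> is
  determined up to combinatorial equivalence; nothing else about the realization is fixed.
\<close>

definition multiplihedron ::
    "nat \<Rightarrow> ('b::euclidean_space) set \<Rightarrow> (broken_tree \<Rightarrow> 'b set) \<Rightarrow> bool" where
  "multiplihedron m J \<phi> \<longleftrightarrow>
     polytope J \<and> aff_dim J = int m - 1 \<and>
     (\<forall>i. bij_betw \<phi> {t. (blow_up ^^ i) (corolla m) t}
            {F. F face_of J \<and> F \<noteq> {} \<and> aff_dim F = int m - 1 - int i}) \<and>
     (\<forall>t\<in>broken_trees m. \<forall>t'\<in>broken_trees m. \<phi> t \<subseteq> \<phi> t' \<longleftrightarrow> blow_up\<^sup>*\<^sup>* t' t)"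


section \<open>The subdivided simplex\<close>

text \<open>
  Euclidean spaces have positive dimension as types, so \<open>\<real>\<^sup>n\<close> with \<open>n \<ge> 0\<close> is taken to be the
  coordinate subspace spanned by \<open>n\<close> distinct basis vectors \<open>b 1, \<dots>, b n\<close> of some Euclidean space.
\<close>

definition coordinate_frame :: "(nat \<Rightarrow> 'a::euclidean_space) \<Rightarrow> nat \<Rightarrow> bool" where
  "coordinate_frame b n \<longleftrightarrow> inj_on b {1..n} \<and> b ` {1..n} \<subseteq> Basis"

text \<open>The coordinates \<open>z\<^sub>1, \<dots>, z\<^sub>n\<close>, with the conventions \<open>z\<^sub>0 = 1\<close> and \<open>z\<^sub>n\<^sub>+\<^sub>1 = 0\<close>.\<close>

definition crd :: "(nat \<Rightarrow> 'a::euclidean_space) \<Rightarrow> nat \<Rightarrow> 'a \<Rightarrow> nat \<Rightarrow> real" where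
  "crd b n z i = (if i = 0 then 1 else if i \<le> n then z \<bullet> b i else 0)"

definition std_simplex :: "(nat \<Rightarrow> 'a::euclidean_space) \<Rightarrow> nat \<Rightarrow> 'a set" where
  "std_simplex b n = {z \<in> span (b ` {1..n}). \<forall>i\<in>{0..n}. crd b n z i \<ge> crd b n z (Suc i)}"

text \<open>
  All closed cells, of every dimension, of the simplex subdivided by the hyperplanes \<open>z\<^sub>i = t\<close>
  with \<open>1 \<le> i \<le> n\<close> and \<open>t\<close> in the list \<open>a\<close>: the relatively open cell of a point \<open>x\<close> consists of the
  points that lie in the relative interior of the same face and on the same side of every
  hyperplane (or on it, if \<open>x\<close> is).
\<close>

definition subdivided_simplex ::
    "(nat \<Rightarrow> 'a::euclidean_space) \<Rightarrow> nat \<Rightarrow> real list \<Rightarrow> 'a set set" where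
  "subdivided_simplex b n a =
     {closure {y \<in> rel_interior G. \<forall>i\<in>{1..n}. \<forall>t\<in>set a. sgn (y \<bullet> b i - t) = sgn (x \<bullet> b i - t)}
      | G x. G face_of std_simplex b n \<and> x \<in> rel_interior G}"

text \<open>A face of the simplex is represented by its nonempty set of vertices, the vertex \<open>b 1 + \<dots> + b k\<close>
  being written \<open>k\<close>.\<close>

definition overlapping_partition :: "nat \<Rightarrow> nat set list \<Rightarrow> bool" where
  "overlapping_partition n Is \<longleftrightarrow>
     (\<forall>I\<in>set Is. I \<noteq> {} \<and> I \<subseteq> {0..n}) \<and> \<Union>(set Is) = {0..n} \<and>
     (\<forall>l. Suc l < length Is \<longrightarrow> Max (Is ! l) = Min (Is ! Suc l))"

text \<open>
  The top dimensional cell labeled by \<open>I\<^sub>1 \<union> \<dots> \<union> I\<^bsub>r+1\<^esub>\<close>, where \<open>i\<^sub>k = Max I\<^sub>k\<close>. Lists are indexed from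
  0, so \<open>a ! k\<close> is \<open>a\<^sub>k\<^sub>+\<^sub>1\<close> and \<open>Is ! k\<close> is \<open>I\<^sub>k\<^sub>+\<^sub>1\<close>.
\<close>

definition labeled_cell ::
    "(nat \<Rightarrow> 'a::euclidean_space) \<Rightarrow> nat \<Rightarrow> real list \<Rightarrow> nat set list \<Rightarrow> 'a set" where
  "labeled_cell b n a Is =
     {z \<in> std_simplex b n. \<forall>k<length a.
        crd b n z (Max (Is ! k)) \<ge> a ! k \<and> a ! k \<ge> crd b n z (Suc (Max (Is ! k)))}"


section \<open>The \<open>n\<close>-multiplihedron\<close>

text \<open>For \<open>js = [i\<^sub>1, \<dots>, i\<^sub>s]\<close>, the decreasing list of the \<open>(i\<^sub>1 + \<dots> + i\<^bsub>s-k\<^esub>) / m\<close> with \<open>1 \<le> k < s\<close>.\<close>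

definition thresholds :: "nat \<Rightarrow> nat list \<Rightarrow> real list" where
  "thresholds m js =
     map (\<lambda>k. real (sum_list (take (length js - k) js)) / real m) [1..<length js]"

text \<open>The cells of all dimensions of the refined subdivision of \<open>\<Delta>\<^sup>n \<times> J\<^sub>m\<close>.\<close>

definition n_multiplihedron ::
    "(nat \<Rightarrow> 'a::euclidean_space) \<Rightarrow> nat \<Rightarrow> nat \<Rightarrow> (broken_tree \<Rightarrow> ('b::euclidean_space) set) \<Rightarrow>
     ('a \<times> 'b) set set" where
  "n_multiplihedron b n m \<phi> =
     {C \<times> \<phi> t | C t. t \<in> broken_trees m \<and>
        C \<in> subdivided_simplex b n (thresholds m (leaves_above t))}"

definition top_cell ::
    "(nat \<Rightarrow> 'a::euclidean_space) \<Rightarrow> nat \<Rightarrow> nat \<Rightarrow> (broken_tree \<Rightarrow> ('b::euclidean_space) set) \<Rightarrow>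
     ('a \<times> 'b) set \<Rightarrow> bool" where
  "top_cell b n m \<phi> c \<longleftrightarrow> c \<in> n_multiplihedron b n m \<phi> \<and> aff_dim c = int n + int m - 1"

definition sing_cells ::
    "(nat \<Rightarrow> 'a::euclidean_space) \<Rightarrow> nat \<Rightarrow> ('b::euclidean_space) set \<Rightarrow> ('a \<times> 'b) set set" where
  "sing_cells b n J = {I \<times> J | I. I facet_of std_simplex b n}"

text \<open>The cells \<open>[n-J\<^sub>k] \<times>\<^sub>i [K\<^sub>h]\<close>.\<close>

definition JK_cells ::
    "(nat \<Rightarrow> 'a::euclidean_space) \<Rightarrow> nat \<Rightarrow> nat \<Rightarrow> (broken_tree \<Rightarrow> ('b::euclidean_space) set) \<Rightarrow>
     ('a \<times> 'b) set set" where
  "JK_cells b n m \<phi> =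
     {std_simplex b n \<times> \<phi> (label_JK k i h) | h k i. h + k = m + 1 \<and> 1 \<le> i \<and> i \<le> k \<and> 2 \<le> h}"

text \<open>The cells \<open>[K\<^sub>s] \<times> [dim(I\<^sub>1)-J\<^bsub>i\<^sub>1\<^esub>] \<times> \<dots> \<times> [dim(I\<^sub>s)-J\<^bsub>i\<^sub>s\<^esub>]\<close>, with \<open>js = [i\<^sub>1, \<dots>, i\<^sub>s]\<close>.\<close>

definition KJ_cells ::
    "(nat \<Rightarrow> 'a::euclidean_space) \<Rightarrow> nat \<Rightarrow> nat \<Rightarrow> (broken_tree \<Rightarrow> ('b::euclidean_space) set) \<Rightarrow>
     ('a \<times> 'b) set set" where
  "KJ_cells b n m \<phi> =
     {labeled_cell b n (thresholds m (leaves_above (label_KJ js))) Is \<times> \<phi> (label_KJ js) | js Is.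
        2 \<le> length js \<and> (\<forall>j\<in>set js. 1 \<le> j) \<and> sum_list js = m \<and>
        length Is = length js \<and> overlapping_partition n Is}"

end

theory Submission
  imports Defs
begin

text \<open>
  The label of the open face of \<open>J\<close> is the two-colored corolla, which contains a single unbroken
  two-colored tree; its list of thresholds is empty, so \<open>\<Delta>\<^sup>n \<times> J\<close> is not subdivided. It is the top
  dimensional cell (\<open>top_cell_iff\<close>): every other label has a face of smaller dimension, and over
  \<open>J\<close> itself the other cells are products with proper faces of \<open>\<Delta>\<^sup>n\<close>. Its relative boundary is
  \<open>\<partial>\<Delta>\<^sup>n \<times> J \<union> \<Delta>\<^sup>n \<times> \<partial>J\<close>, and both boundaries are unions of facets, the two factors being polyhedra.

  The facets of \<open>\<Delta>\<^sup>n\<close> give the singular boundary. The facets of \<open>J\<close> are labeled by the trees that one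
  blow-up produces from the corolla: a blue corolla splits off above, or a red corolla splits
  off below (\<open>blow_up_corolla_iff\<close>). The first kind of tree still contains one two-colored vertex, so
  \<open>\<Delta>\<^sup>n\<close> stays undivided over that facet. Over a facet of the second kind \<open>\<Delta>\<^sup>n\<close> is cut by the
  thresholds, and what has to be shown is that the cells labeled by the overlapping partitions

  \<^item> are cells of the subdivision, which needs a point of the open simplex lying strictly on the
    prescribed side of every cutting hyperplane (\<open>generic_point\<close>, \<open>labeled_cell_in_subdivided_simplex\<close>);
  \<^item> together cover \<open>\<Delta>\<^sup>n\<close>: since the coordinates of a point decrease, each threshold cuts them
    into an initial part and a final part (\<open>labeled_cells_cover\<close>).
\<close>

section \<open>Products of convex sets\<close>

text \<open>
  After translating both factors so that they contain the origin, affine dimension becomes linear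
  dimension, and the span of the product is the product of the spans. The factors must be
  nonempty since the empty set has affine dimension \<open>-1\<close>.
\<close>

lemma aff_dim_Times:
  fixes A :: "'a::euclidean_space set" and B :: "'b::euclidean_space set"
  assumes "A \<noteq> {}" "B \<noteq> {}"
  shows "aff_dim (A \<times> B) = aff_dim A + aff_dim B"
proof -
  obtain a b where a: "a \<in> A" and b: "b \<in> B"
    using assms by blast
  define A' where "A' = (+) (- a) ` A"
  define B' where "B' = (+) (- b) ` B"
  have "0 \<in> A'" "0 \<in> B'"
    using a b unfolding A'_def B'_def by force+
  have "(\<lambda>x. (x, 0)) ` A' \<subseteq> A' \<times> B'" "Pair 0 ` B' \<subseteq> A' \<times> B'"
    using \<open>0 \<in> A'\<close> \<open>0 \<in> B'\<close> by auto
  then have "span ((\<lambda>x. (x, 0)) ` A') \<subseteq> span (A' \<times> B')" "span (Pair 0 ` B') \<subseteq> span (A' \<times> B')"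
    by (simp_all only: span_mono)
  moreover have "linear (\<lambda>x::'a. (x, 0::'b))" "linear (Pair (0::'a) :: 'b \<Rightarrow> _)"
    by (auto intro!: linearI)
  ultimately have "(x, 0) \<in> span (A' \<times> B')" "(0, y) \<in> span (A' \<times> B')"
    if "x \<in> span A'" "y \<in> span B'" for x y
    using that by (auto simp: linear_span_image)
  then have "(x, y) \<in> span (A' \<times> B')" if "x \<in> span A'" "y \<in> span B'" for x y
    using that span_add[of "(x, 0)" "A' \<times> B'" "(0, y)"] by simp
  moreover have "span (A' \<times> B') \<subseteq> span A' \<times> span B'"
    by (rule span_minimal) (auto intro: span_base subspace_Times)
  ultimately have span: "span (A' \<times> B') = span A' \<times> span B'"
    by auto
  have "(+) (- (a, b)) ` (A \<times> B) = A' \<times> B'"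
    unfolding A'_def B'_def by (auto simp: image_iff)
  then have "aff_dim (A \<times> B) = int (dim (A' \<times> B'))"
    using a b by (subst aff_dim_eq_dim[of "(a, b)"]) (auto intro: hull_inc)
  also have "dim (A' \<times> B') = dim A' + dim B'"
    by (metis span dim_span dim_Times subspace_span)
  finally show ?thesis
    using a b aff_dim_eq_dim[of a A] aff_dim_eq_dim[of b B]
    by (simp add: A'_def B'_def hull_inc)
qed

lemma rel_frontier_Times:
  fixes A :: "'a::euclidean_space set" and B :: "'b::euclidean_space set"
  assumes "convex A" "closed A" "convex B" "closed B"
  shows "rel_frontier (A \<times> B) = rel_frontier A \<times> B \<union> A \<times> rel_frontier B"
  using assms rel_interior_subset[of A] rel_interior_subset[of B]
  by (auto simp: rel_frontier_def closure_Times rel_interior_Times)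

section \<open>The simplex\<close>

lemma crd_combination:
  assumes "coordinate_frame b n" "j \<in> {1..n}"
  shows "crd b n (\<Sum>i=1..n. f i *\<^sub>R b i) j = f j"
proof -
  have "b i \<bullet> b j = (if i = j then 1 else 0)" if "i \<in> {1..n}" for i
    using assms that unfolding coordinate_frame_def
    by (metis image_subset_iff inj_on_eq_iff inner_Basis)
  then have "(\<Sum>i=1..n. f i *\<^sub>R b i) \<bullet> b j = (\<Sum>i=1..n. if i = j then f i else 0)"
    unfolding inner_sum_left by (intro sum.cong) auto
  also have "\<dots> = f j"
    using assms by simp
  finally show ?thesis
    using assms by (simp add: crd_def)
qed

lemma continuous_on_crd: "continuous_on A (\<lambda>z. crd b n z i)"
  unfolding crd_def by (cases "i = 0"; cases "i \<le> n") (auto intro!: continuous_intros)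

lemma crd_antimono:
  assumes "z \<in> std_simplex b n" "i \<le> j"
  shows "crd b n z j \<le> crd b n z i"
  using assms(2)
proof (induction j rule: dec_induct)
  case (step j)
  have "crd b n z (Suc j) \<le> crd b n z j"
    using assms(1) by (cases "j \<le> n") (auto simp: std_simplex_def crd_def)
  then show ?case
    using step by linarith
qed simp

lemma polyhedron_std_simplex: "polyhedron (std_simplex b n)"
proof -
  have "polyhedron {z. crd b n z (Suc i) \<le> crd b n z i}" if "i \<le> n" for i
  proof -
    consider "i = 0" "n = 0" | "i = 0" "0 < n" | "0 < i" "i < n" | "0 < i" "i = n"
      using \<open>i \<le> n\<close> by (cases "i = 0"; cases "i = n") auto
    then show ?thesis
    proof cases
      case 2
      then show ?thesis
        using polyhedron_halfspace_le[of "b 1" 1] by (simp add: crd_def inner_commute)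
    next
      case 3
      then show ?thesis
        using polyhedron_halfspace_le[of "b (Suc i) - b i" 0]
        by (simp add: crd_def inner_commute inner_diff_right)
    next
      case 4
      then show ?thesis
        using polyhedron_halfspace_ge[of 0 "b i"] by (simp add: crd_def inner_commute)
    qed (simp add: crd_def)
  qed
  then have "polyhedron (span (b ` {1..n}) \<inter> \<Inter> ((\<lambda>i. {z. crd b n z (Suc i) \<le> crd b n z i}) ` {0..n}))"
    by (intro polyhedron_Int polyhedron_Inter)
       (auto intro: affine_imp_polyhedron subspace_imp_affine)
  also have "\<dots> = std_simplex b n"
    by (auto simp: std_simplex_def)
  finally show ?thesis .
qed

lemma convex_std_simplex: "convex (std_simplex b n)"
  by (simp add: polyhedron_imp_convex polyhedron_std_simplex)

lemma closed_std_simplex: "closed (std_simplex b n)"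
  by (simp add: polyhedron_imp_closed polyhedron_std_simplex)

text \<open>
  Being the trace of an open set on a subspace, this set lies in the relative interior of the
  simplex and, once it is known to be nonempty, has the dimension of the subspace.
\<close>

definition open_simplex :: "(nat \<Rightarrow> 'a::euclidean_space) \<Rightarrow> nat \<Rightarrow> 'a set" where
  "open_simplex b n = span (b ` {1..n}) \<inter> (\<Inter>i\<in>{0..n}. {z. crd b n z (Suc i) < crd b n z i})"

lemma open_simplex_halfspaces:
  "open (\<Inter>i\<in>{0..n}. {z. crd b n z (Suc i) < crd b n z i})"
  by (intro open_INT) (auto intro: open_Collect_less continuous_on_crd)

lemma open_simplex_subset_rel_interior: "open_simplex b n \<subseteq> rel_interior (std_simplex b n)"
proof
  fix x assume x: "x \<in> open_simplex b n"
  let ?T = "\<Inter>i\<in>{0..n}. {z. crd b n z (Suc i) < crd b n z i}"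
  have "affine hull (std_simplex b n) \<subseteq> span (b ` {1..n})"
    by (intro hull_minimal subspace_imp_affine) (auto simp: std_simplex_def)
  moreover have "span (b ` {1..n}) \<inter> ?T \<subseteq> std_simplex b n"
    by (auto simp: std_simplex_def less_imp_le)
  ultimately have "x \<in> ?T \<inter> std_simplex b n" "?T \<inter> affine hull (std_simplex b n) \<subseteq> std_simplex b n"
    using x unfolding open_simplex_def by blast+
  then show "x \<in> rel_interior (std_simplex b n)"
    unfolding mem_rel_interior using open_simplex_halfspaces by blast
qed

text \<open>
  The numbers \<open>1 > a\<^sub>1 > \<dots> > a\<^sub>r > 0\<close> cut the unit interval into \<open>r + 1\<close> gaps. The conditions on the
  \<open>i\<close>-th coordinate say exactly which gap contains it: the one after the \<open>q i\<close> thresholds whose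
  position \<open>p k\<close> is before \<open>i\<close>. As \<open>q\<close> is monotone, it suffices to choose the coordinates decreasing
  inside each gap.
\<close>

lemma generic_point:
  fixes b :: "nat \<Rightarrow> 'a::euclidean_space"
  assumes frame: "coordinate_frame b n"
    and a: "sorted_wrt (>) a" "set a \<subseteq> {0<..<1}"
    and p: "\<And>k l. k \<le> l \<Longrightarrow> l < length a \<Longrightarrow> p k \<le> (p l :: nat)"
  obtains x where "x \<in> open_simplex b n"
    and "\<And>i k. i \<in> {1..n} \<Longrightarrow> k < length a \<Longrightarrow> i \<le> p k \<Longrightarrow> a ! k < x \<bullet> b i"
    and "\<And>i k. i \<in> {1..n} \<Longrightarrow> k < length a \<Longrightarrow> p k < i \<Longrightarrow> x \<bullet> b i < a ! k"
proof -
  define r where "r = length a"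
  \<comment> \<open>the thresholds together with the two ends \<open>A 0 = 1\<close> and \<open>A (Suc r) = 0\<close>\<close>
  define A where "A k = (1 # a @ [0]) ! k" for k
  define q where "q i = card {k. k < r \<and> p k < i}" for i
  \<comment> \<open>relative height inside a gap: strictly decreasing in \<open>i\<close>, so that coordinates in the same
     gap are separated as well\<close>
  define w where "w i = real (n + 1 - i) / real (n + 1)" for i
  define f where "f i = A (Suc (q i)) + (A (q i) - A (Suc (q i))) * w i" for i
  define x where "x = (\<Sum>i=1..n. f i *\<^sub>R b i)"
  have sorted: "sorted_wrt (>) (1 # a @ [0])"
    using a by (auto simp: sorted_wrt_append)
  have A_less: "A l < A k" if "k < l" "l \<le> Suc r" for k l
    using sorted_wrt_nth_less[OF sorted that(1)] that(2) unfolding A_def r_def by simp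
  then have A_le: "A l \<le> A k" if "k \<le> l" "l \<le> Suc r" for k l
    using that by (cases "k = l") (auto intro: less_imp_le)
  have A_nth: "A (Suc k) = a ! k" if "k < r" for k
    using that by (simp add: A_def r_def nth_append)
  have A_ends: "A 0 = 1" "A (Suc r) = 0"
    by (simp_all add: A_def r_def nth_append)
  have q_le_r: "q i \<le> r" for i
  proof -
    have "q i \<le> card {..<r}"
      unfolding q_def by (intro card_mono) auto
    then show ?thesis by simp
  qed
  have q_mono: "q i \<le> q j" if "i \<le> j" for i j
    unfolding q_def using that by (intro card_mono) auto
  have q_le: "q i \<le> k" if "k < r" "i \<le> p k" for i k
  proof -
    have "k' < k" if "k' < r" "p k' < i" for k'
      using p[of k k'] that \<open>i \<le> p k\<close> by (cases "k' < k") (auto simp: r_def)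
    then have "{k'. k' < r \<and> p k' < i} \<subseteq> {..<k}"
      by auto
    then have "q i \<le> card {..<k}"
      unfolding q_def by (intro card_mono) auto
    then show ?thesis by simp
  qed
  have q_gt: "k < q i" if "k < r" "p k < i" for i k
  proof -
    have "p k' < i" if "k' \<le> k" for k'
      using p[OF that] \<open>k < r\<close> \<open>p k < i\<close> by (simp add: r_def)
    then have "{..k} \<subseteq> {k'. k' < r \<and> p k' < i}"
      using that by auto
    then have "card {..k} \<le> q i"
      unfolding q_def by (intro card_mono) auto
    then show ?thesis by simp
  qed
  have f_bounds: "A (Suc (q i)) < f i" "f i < A (q i)" if "i \<in> {1..n}" for i
  proof -
    have "0 < w i" "w i < 1"
      using that by (auto simp: w_def of_nat_diff)
    moreover have "0 < A (q i) - A (Suc (q i))"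
      using A_less q_le_r by simp
    ultimately have "0 < (A (q i) - A (Suc (q i))) * w i"
      "(A (q i) - A (Suc (q i))) * w i < A (q i) - A (Suc (q i))"
      using mult_strict_left_mono[of "w i" 1 "A (q i) - A (Suc (q i))"]
      by (simp, simp only: mult_1_right)
    then show "A (Suc (q i)) < f i" "f i < A (q i)"
      unfolding f_def by linarith+
  qed
  have f_less: "f (Suc i) < f i" if "i \<in> {1..<n}" for i
  proof (cases "q i = q (Suc i)")
    case True
    have "w (Suc i) < w i"
      using that by (auto simp: w_def divide_simps of_nat_diff)
    moreover have "A (Suc (q i)) < A (q i)"
      using A_less q_le_r by simp
    ultimately show ?thesis
      using True by (simp add: f_def)
  next
    case False
    then have "A (q (Suc i)) \<le> A (Suc (q i))"
      using q_mono[of i "Suc i"] q_le_r[of "Suc i"] by (intro A_le) auto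
    then show ?thesis
      using f_bounds[of i] f_bounds[of "Suc i"] that by force
  qed
  have f01: "0 < f i" "f i < 1" if "i \<in> {1..n}" for i
    using f_bounds[OF that] A_le[of 0 "q i"] A_le[of "Suc (q i)" "Suc r"] q_le_r[of i]
    unfolding A_ends by auto
  have crd_x: "crd b n x i = f i" if "i \<in> {1..n}" for i
    unfolding x_def by (rule crd_combination[OF frame that])
  then have inner_x: "x \<bullet> b i = f i" if "i \<in> {1..n}" for i
    using that by (auto simp: crd_def)
  have "crd b n x (Suc i) < crd b n x i" if "i \<le> n" for i
    using that crd_x[of i] crd_x[of "Suc i"] f01[of i] f01[of "Suc i"] f_less[of i]
    by (cases "i = 0"; cases "i = n") (auto simp: crd_def)
  moreover have "x \<in> span (b ` {1..n})"
    unfolding x_def by (intro span_sum span_scale span_base) auto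
  ultimately have "x \<in> open_simplex b n"
    by (auto simp: open_simplex_def)
  moreover have "a ! k < x \<bullet> b i" if "i \<in> {1..n}" "k < length a" "i \<le> p k" for i k
    using that f_bounds[of i] inner_x[of i] q_le[of k i] A_nth[of k] A_le[of "Suc (q i)" "Suc k"]
    by (auto simp: r_def)
  moreover have "x \<bullet> b i < a ! k" if "i \<in> {1..n}" "k < length a" "p k < i" for i k
    using that f_bounds[of i] inner_x[of i] q_gt[of k i] q_le_r[of i] A_nth[of k]
      A_le[of "Suc k" "q i"]
    by (auto simp: r_def)
  ultimately show ?thesis
    by (rule that)
qed

lemma open_simplex_nonempty:
  assumes "coordinate_frame b n"
  shows "open_simplex b n \<noteq> {}"
  using generic_point[OF assms, of "[]"] by (metis empty_iff empty_subsetI length_0_conv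
      list.set(1) not_less_zero sorted_wrt.simps(1))

lemma aff_dim_std_simplex:
  assumes "coordinate_frame b n"
  shows "aff_dim (std_simplex b n) = int n"
proof -
  let ?V = "span (b ` {1..n})"
  have "independent (b ` {1..n})" "card (b ` {1..n}) = n"
    using assms independent_substdbasis[of "b ` {1..n}"]
    by (simp_all add: coordinate_frame_def card_image)
  then have V: "aff_dim ?V = int n"
    by (simp add: aff_dim_subspace dim_eq_card_independent)
  have "aff_dim (open_simplex b n) = aff_dim ?V"
    using open_simplex_nonempty[OF assms] unfolding open_simplex_def
    by (intro aff_dim_convex_Int_open open_simplex_halfspaces) (auto intro: subspace_imp_convex)
  moreover have "open_simplex b n \<subseteq> std_simplex b n" "std_simplex b n \<subseteq> ?V"
    using open_simplex_subset_rel_interior rel_interior_subset by (blast, auto simp: std_simplex_def)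
  ultimately show ?thesis
    using V aff_dim_subset by (metis order_antisym)
qed

section \<open>The cells of the subdivided simplex\<close>

lemma subdivided_simplex_subset:
  assumes "C \<in> subdivided_simplex b n a"
  shows "C \<subseteq> std_simplex b n"
proof -
  obtain G D where G: "G face_of std_simplex b n" and C: "C = closure D" and D: "D \<subseteq> rel_interior G"
    using assms unfolding subdivided_simplex_def by (auto intro: that)
  have "D \<subseteq> std_simplex b n"
    using face_of_imp_subset[OF G] rel_interior_subset D by blast
  then show ?thesis
    unfolding C by (rule closure_minimal[OF _ closed_std_simplex])
qed

lemma subdivided_simplex_nonempty:
  assumes "C \<in> subdivided_simplex b n a"
  shows "C \<noteq> {}"
  using assms by (auto simp: subdivided_simplex_def)

text \<open>
  With no hyperplane the open cells are the relative interiors of the faces, whose closures are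
  the faces themselves.
\<close>

lemma subdivided_simplex_Nil:
  "subdivided_simplex b n [] = {G. G face_of std_simplex b n \<and> G \<noteq> {}}"
proof -
  have "closure (rel_interior G) = G" "rel_interior G = {} \<longleftrightarrow> G = {}"
    if "G face_of std_simplex b n" for G
    using that face_of_imp_convex[OF that] face_of_imp_closed[OF convex_std_simplex closed_std_simplex that]
    by (auto simp: convex_closure_rel_interior rel_interior_eq_empty)
  then show ?thesis
    unfolding subdivided_simplex_def by (simp, metis (lifting) ex_in_conv)
qed

text \<open>
  A generic point \<open>x\<close> singles out an open cell \<open>U\<close> of the open simplex, defined by strict
  inequalities whose weak versions define the labeled cell. So \<open>U\<close> is contained in the labeled
  cell, which is closed; conversely, moving any point of the labeled cell a little towards \<open>x\<close>
  makes all the inequalities strict, so \<open>U\<close> is dense in it. The weak inequalities bound only the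
  two coordinates next to the cut, and monotonicity of the coordinates transfers them to the
  others.
\<close>

lemma labeled_cell_in_subdivided_simplex:
  assumes frame: "coordinate_frame b n"
    and a: "sorted_wrt (>) a" "set a \<subseteq> {0<..<1}"
    and Is: "overlapping_partition n Is" "length a < length Is"
  shows "labeled_cell b n a Is \<in> subdivided_simplex b n a"
proof -
  let ?S = "std_simplex b n"
  define p where "p k = Max (Is ! k)" for k
  have I: "Is ! k \<noteq> {}" "Is ! k \<subseteq> {0..n}" "finite (Is ! k)" if "k < length Is" for k
    using Is(1) that unfolding overlapping_partition_def
    by (metis nth_mem, metis nth_mem, metis nth_mem finite_atLeastAtMost finite_subset)
  have p_le: "p k \<le> n" if "k < length Is" for k
    using I[OF that] Max_in[of "Is ! k"] unfolding p_def by auto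
  have p_mono: "p k \<le> p l" if "k \<le> l" "l < length a" for k l
    using that
  proof (induction l rule: dec_induct)
    case (step l)
    have "p l = Min (Is ! Suc l)"
      using Is step unfolding overlapping_partition_def p_def by simp
    also have "\<dots> \<le> p (Suc l)"
      using I[of "Suc l"] Is step unfolding p_def by (intro Min.coboundedI Max_in) auto
    finally show ?case
      using step by simp
  qed simp
  obtain x where x: "x \<in> open_simplex b n"
    and above: "\<And>i k. i \<in> {1..n} \<Longrightarrow> k < length a \<Longrightarrow> i \<le> p k \<Longrightarrow> a ! k < x \<bullet> b i"
    and below: "\<And>i k. i \<in> {1..n} \<Longrightarrow> k < length a \<Longrightarrow> p k < i \<Longrightarrow> x \<bullet> b i < a ! k"
    using generic_point[OF frame a, of p] p_mono by blast
  have x_int: "x \<in> rel_interior ?S"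
    using x open_simplex_subset_rel_interior by blast
  define U where
    "U = {y \<in> rel_interior ?S. \<forall>i\<in>{1..n}. \<forall>t\<in>set a. sgn (y \<bullet> b i - t) = sgn (x \<bullet> b i - t)}"
  have a01: "0 < a ! k" "a ! k < 1" if "k < length a" for k
    using a(2) nth_mem[OF that] by auto
  have "U \<subseteq> labeled_cell b n a Is"
  proof
    fix y assume y: "y \<in> U"
    have sgn: "sgn (y \<bullet> b i - a ! k) = sgn (x \<bullet> b i - a ! k)" if "i \<in> {1..n}" "k < length a" for i k
      using y that unfolding U_def by simp
    have y_above: "a ! k < y \<bullet> b i" if "i \<in> {1..n}" "k < length a" "i \<le> p k" for i k
      using sgn[OF that(1,2)] above[OF that] by (metis diff_gt_0_iff_gt sgn_greater)
    have y_below: "y \<bullet> b i < a ! k" if "i \<in> {1..n}" "k < length a" "p k < i" for i k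
      using sgn[OF that(1,2)] below[OF that] by (metis diff_less_0_iff_less sgn_less)
    have "a ! k \<le> crd b n y (p k)" if "k < length a" for k
      using y_above[of "p k" k] a01[OF that] that p_le[of k] Is(2)
      by (cases "p k = 0") (auto simp: crd_def)
    moreover have "crd b n y (Suc (p k)) \<le> a ! k" if "k < length a" for k
      using y_below[of "Suc (p k)" k] a01[OF that] that
      by (cases "Suc (p k) \<le> n") (auto simp: crd_def)
    ultimately show "y \<in> labeled_cell b n a Is"
      using y rel_interior_subset[of ?S] by (auto simp: labeled_cell_def U_def p_def)
  qed
  moreover have "closed (labeled_cell b n a Is)"
  proof -
    have "labeled_cell b n a Is = ?S \<inter> (\<Inter>k\<in>{..<length a}.
        {z. a ! k \<le> crd b n z (Max (Is ! k))} \<inter> {z. crd b n z (Suc (Max (Is ! k))) \<le> a ! k})"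
      by (auto simp: labeled_cell_def)
    moreover have "closed \<dots>"
      by (intro closed_Int closed_INT closed_std_simplex ballI closed_Collect_le
          continuous_on_crd continuous_on_const)
    ultimately show ?thesis by simp
  qed
  moreover have "labeled_cell b n a Is \<subseteq> closure U"
  proof
    fix z assume z: "z \<in> labeled_cell b n a Is"
    then have zS: "z \<in> ?S"
      by (simp add: labeled_cell_def)
    have seg: "z - e *\<^sub>R (z - x) \<in> U" if e: "0 < e" "e \<le> 1" for e
    proof -
      have "sgn ((z - e *\<^sub>R (z - x)) \<bullet> b i - a ! k) = sgn (x \<bullet> b i - a ! k)"
        if i: "i \<in> {1..n}" and k: "k < length a" for i k
      proof -
        have eq: "(z - e *\<^sub>R (z - x)) \<bullet> b i - a ! k
            = (1 - e) * (z \<bullet> b i - a ! k) + e * (x \<bullet> b i - a ! k)"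
          by (simp add: inner_simps algebra_simps)
        have zi: "z \<bullet> b i = crd b n z i"
          using i by (auto simp: crd_def)
        show ?thesis
        proof (cases "i \<le> p k")
          case True
          have "a ! k \<le> crd b n z (p k)"
            using z k by (simp add: labeled_cell_def p_def)
          then have "0 \<le> z \<bullet> b i - a ! k"
            using crd_antimono[OF zS True] zi by simp
          moreover have "0 < x \<bullet> b i - a ! k"
            using above[OF i k True] by simp
          ultimately show ?thesis
            unfolding eq using e by (simp add: add_nonneg_pos)
        next
          case False
          have "crd b n z (Suc (p k)) \<le> a ! k"
            using z k by (simp add: labeled_cell_def p_def)
          then have "z \<bullet> b i - a ! k \<le> 0"
            using crd_antimono[OF zS, of "Suc (p k)" i] False zi by simp
          moreover have "x \<bullet> b i - a ! k < 0"
            using below[OF i k] False by simp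
          ultimately have "(1 - e) * (z \<bullet> b i - a ! k) + e * (x \<bullet> b i - a ! k) < 0"
            using e by (intro add_nonpos_neg mult_nonneg_nonpos mult_pos_neg) auto
          with \<open>x \<bullet> b i - a ! k < 0\<close> show ?thesis
            unfolding eq by simp
        qed
      qed
      moreover have "z - e *\<^sub>R (z - x) \<in> rel_interior ?S"
        by (rule rel_interior_convex_shrink[OF convex_std_simplex x_int zS e])
      ultimately show ?thesis
        unfolding U_def by (auto simp: in_set_conv_nth)
    qed
    have "(\<lambda>N. z - inverse (real (Suc N)) *\<^sub>R (z - x)) \<longlonglongrightarrow> z - 0 *\<^sub>R (z - x)"
      by (intro tendsto_intros LIMSEQ_inverse_real_of_nat)
    moreover have "z - inverse (real (Suc N)) *\<^sub>R (z - x) \<in> U" for N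
      by (rule seg) (auto simp: inverse_le_1_iff)
    ultimately show "z \<in> closure U"
      unfolding closure_sequential
      by (intro exI[of _ "\<lambda>N. z - inverse (real (Suc N)) *\<^sub>R (z - x)"]) simp
  qed
  ultimately have "labeled_cell b n a Is = closure U"
    using closure_minimal by blast
  then show ?thesis
    unfolding subdivided_simplex_def U_def
    using x_int face_of_refl[OF convex_std_simplex] by blast
qed

text \<open>
  For a given point, the \<open>k\<close>-th cut is placed after the last coordinate that is at least \<open>a\<^sub>k\<close>. The
  convention \<open>z\<^sub>0 = 1 > a\<^sub>k\<close> ensures that there is one, and the cuts move to the right with \<open>k\<close>
  because the thresholds decrease. The intervals between consecutive cuts, each sharing its
  endpoints with its neighbours, form the partition.
\<close>

lemma labeled_cells_cover:
  assumes z: "z \<in> std_simplex b n" and a: "sorted_wrt (>) a" "set a \<subseteq> {0<..<1}"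
  shows "\<exists>Is. overlapping_partition n Is \<and> length Is = Suc (length a) \<and> z \<in> labeled_cell b n a Is"
proof -
  define r where "r = length a"
  \<comment> \<open>the interval with index \<open>r\<close> is the last one and ends at \<open>n\<close>\<close>
  define p where "p k = (if k < r then Max {i\<in>{0..n}. a ! k \<le> crd b n z i} else n)" for k
  define low where "low k = (if k = 0 then 0 else p (k - 1))" for k
  define Is where "Is = map (\<lambda>k. {low k..p k}) [0..<Suc r]"
  have a01: "0 < a ! k" "a ! k < 1" if "k < r" for k
    using subsetD[OF a(2) nth_mem, of k] that unfolding r_def by auto
  have p_mem: "p k \<in> {i\<in>{0..n}. a ! k \<le> crd b n z i}" if "k < r" for k
  proof -
    have "0 \<in> {i\<in>{0..n}. a ! k \<le> crd b n z i}"
      using a01[OF that] by (simp add: crd_def)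
    then have "Max {i\<in>{0..n}. a ! k \<le> crd b n z i} \<in> {i\<in>{0..n}. a ! k \<le> crd b n z i}"
      by (intro Max_in) auto
    then show ?thesis
      unfolding p_def using that by simp
  qed
  have p_ge: "i \<le> p k" if "k < r" "i \<le> n" "a ! k \<le> crd b n z i" for i k
    unfolding p_def using that by (auto intro: Max_ge)
  have p_n: "p k \<le> n" for k
    using p_mem[of k] by (cases "k < r") (auto simp: p_def)
  have p_mono: "p k \<le> p (Suc k)" if "k < r" for k
  proof (cases "Suc k < r")
    case True
    have "a ! Suc k < a ! k"
      using sorted_wrt_nth_less[OF a(1), of k "Suc k"] True by (simp add: r_def)
    then show ?thesis
      using p_mem[OF that] by (intro p_ge[OF True]) auto
  qed (use p_n in \<open>simp add: p_def\<close>)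
  have low_le: "low k \<le> p k" if "k \<le> r" for k
    using p_mono[of "k - 1"] that by (cases k) (auto simp: low_def)
  have Is_nth: "Is ! k = {low k..p k}" if "k \<le> r" for k
    using that unfolding Is_def by (simp add: less_Suc_eq_le del: upt_Suc)
  have len: "length Is = Suc r"
    by (simp add: Is_def)
  have cover: "\<exists>k\<le>r. i \<in> Is ! k" if "i \<le> n" for i
  proof -
    define k where "k = (LEAST k. i \<le> p k)"
    have "i \<le> p r"
      using that by (simp add: p_def)
    then have k: "k \<le> r" "i \<le> p k"
      unfolding k_def by (rule Least_le, rule LeastI)
    have "\<not> i \<le> p l" if "l < k" for l
      using that unfolding k_def by (rule not_less_Least)
    from this[of "k - 1"] have "low k \<le> i"
      by (cases "k = 0") (simp_all add: low_def)
    with k have "i \<in> Is ! k"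
      by (simp add: Is_nth)
    with \<open>k \<le> r\<close> show ?thesis
      by blast
  qed
  have "set Is = {Is ! k | k. k \<le> r}"
    using len by (auto simp: set_conv_nth less_Suc_eq_le)
  then have nonempty: "I \<noteq> {} \<and> I \<subseteq> {0..n}" if I: "I \<in> set Is" for I
  proof -
    obtain k where "k \<le> r" "I = Is ! k"
      using I \<open>set Is = _\<close> by blast
    then show ?thesis
      using Is_nth[of k] low_le[of k] p_n[of k] by auto
  qed
  moreover have "{0..n} \<subseteq> \<Union> (set Is)"
  proof
    fix i assume "i \<in> {0..n}"
    then obtain k where "k \<le> r" "i \<in> Is ! k"
      using cover[of i] by auto
    moreover have "Is ! k \<in> set Is"
      using \<open>k \<le> r\<close> len by simp
    ultimately show "i \<in> \<Union> (set Is)"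
      by blast
  qed
  then have "\<Union> (set Is) = {0..n}"
    by (intro equalityI Union_least) (auto dest: nonempty)
  moreover have "Max (Is ! l) = Min (Is ! Suc l)" if "Suc l < length Is" for l
  proof -
    have "Suc l \<le> r"
      using that len by simp
    then have "Max (Is ! l) = p l" "Min (Is ! Suc l) = low (Suc l)"
      using Is_nth[of l] Is_nth[of "Suc l"] low_le[of l] low_le[of "Suc l"]
      by (auto intro!: Max_eqI Min_eqI)
    then show ?thesis
      by (simp add: low_def)
  qed
  ultimately have "overlapping_partition n Is"
    unfolding overlapping_partition_def by (intro conjI ballI allI impI) metis+
  moreover have "z \<in> labeled_cell b n a Is"
  proof -
    have Max_Is: "Max (Is ! k) = p k" if "k < r" for k
    proof -
      have k: "k \<le> r"
        using that by simp
      have "Max {low k..p k} = p k"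
        using low_le[OF k] by (intro Max_eqI) simp_all
      then show ?thesis
        by (simp only: Is_nth[OF k])
    qed
    have "crd b n z (Suc (p k)) \<le> a ! k" if "k < r" for k
    proof (cases "Suc (p k) \<le> n")
      case True
      show ?thesis
      proof (rule ccontr)
        assume "\<not> ?thesis"
        then have "Suc (p k) \<le> p k"
          by (intro p_ge[OF that True]) simp
        then show False
          by simp
      qed
    qed (use a01[OF that] in \<open>simp add: crd_def\<close>)
    moreover have "a ! k \<le> crd b n z (p k)" if "k < r" for k
      using p_mem[OF that] by simp
    ultimately show ?thesis
      using z Max_Is unfolding labeled_cell_def r_def by auto
  qed
  ultimately show ?thesis
    using len unfolding r_def by blast
qed

section \<open>The codimension one faces of the multiplihedron\<close>

lemma thresholds_singleton [simp]: "thresholds m [j] = []"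
  by (simp add: thresholds_def)

lemma length_thresholds [simp]: "length (thresholds m js) = length js - 1"
  by (simp add: thresholds_def)

text \<open>
  All parts of the composition are positive, so its partial sums increase strictly; the list of
  thresholds omits the extreme partial sums \<open>0\<close> and \<open>m\<close>.
\<close>

lemma thresholds_decreasing:
  assumes "\<forall>j\<in>set js. 1 \<le> j" "sum_list js = m"
  shows "sorted_wrt (>) (thresholds m js)" and "set (thresholds m js) \<subseteq> {0<..<1}"
proof -
  have less: "sum_list (take k js) < sum_list (take l js)" if "k < l" "l \<le> length js" for k l
  proof -
    have "take l js = take k js @ take (l - k) (drop k js)"
      using that by (metis le_add_diff_inverse less_imp_le take_add)
    moreover have "take (l - k) (drop k js) \<noteq> []"
      using that by simp
    moreover have "\<forall>j\<in>set (take (l - k) (drop k js)). 1 \<le> j"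
      using assms(1) by (meson in_set_dropD in_set_takeD)
    ultimately show ?thesis
      by (cases "take (l - k) (drop k js)") auto
  qed
  show "sorted_wrt (>) (thresholds m js)"
    unfolding thresholds_def sorted_wrt_map
  proof (rule sorted_wrt_mono_rel[OF _ sorted_wrt_upt])
    fix k l assume kl: "k \<in> set [1..<length js]" "l \<in> set [1..<length js]" "k < l"
    then have "sum_list (take (length js - l) js) < sum_list (take (length js - k) js)"
      by (intro less) auto
    moreover have "0 < m"
      using less[of 0 "length js"] kl assms by (cases js) auto
    ultimately show "real (sum_list (take (length js - k) js)) / real m
        > real (sum_list (take (length js - l) js)) / real m"
      by (simp add: divide_strict_right_mono)
  qed
  show "set (thresholds m js) \<subseteq> {0<..<1}"
  proof
    fix t assume "t \<in> set (thresholds m js)"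
    then obtain k where k: "1 \<le> k" "k < length js"
      and t: "t = real (sum_list (take (length js - k) js)) / real m"
      by (auto simp: thresholds_def)
    have "0 < sum_list (take (length js - k) js)" "sum_list (take (length js - k) js) < m"
      using less[of 0 "length js - k"] less[of "length js - k" "length js"] k assms by auto
    then show "t \<in> {0<..<1}"
      by (simp add: t)
  qed
qed

lemma sum_list_replicate_1 [simp]: "sum_list (replicate m (Suc 0)) = m"
  by (induction m) auto

lemma leaves_above_corolla: "leaves_above (corolla m) = [m]"
  by (simp add: corolla_def)

lemma leaves_above_label_JK:
  assumes "h + k = m + 1" "1 \<le> i" "i \<le> k"
  shows "leaves_above (label_JK k i h) = [m]"
  using assms by (simp add: label_JK_def)

lemma leaves_above_label_KJ: "leaves_above (label_KJ js) = js"
  by (induction js) (auto simp: label_KJ_def leaves_above_corolla)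

text \<open>
  The inputs of a corolla are leaves, which cannot be blown up, and its vertex is not red. So only
  the two ways of blowing up the two-colored vertex remain, and a list of leaves is
  determined by its length.
\<close>

lemma blow_up_corolla_iff:
  "blow_up (corolla m) t \<longleftrightarrow>
     (\<exists>h k i. t = label_JK k i h \<and> h + k = m + 1 \<and> 1 \<le> i \<and> i \<le> k \<and> 2 \<le> h) \<or>
     (\<exists>js. t = label_KJ js \<and> 2 \<le> length js \<and> (\<forall>j\<in>set js. 1 \<le> j) \<and> sum_list js = m)"
  (is "?L \<longleftrightarrow> ?JK \<or> ?KJ")
proof (intro iffI; (elim disjE)?)
  assume ?L
  have Leaf: "ys = replicate (length ys) Leaf" if "set ys \<subseteq> set (replicate m Leaf)" for ys
    using that by (intro replicate_eqI[symmetric, THEN sym]) (auto split: if_splits)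
  from \<open>?L\<close> show "?JK \<or> ?KJ"
    unfolding corolla_def
  proof cases
    case (two_colored_above ys xs zs)
    have *: "replicate m Leaf = xs @ ys @ zs"
      using two_colored_above by simp
    have "set xs \<subseteq> set (replicate m Leaf)" "set ys \<subseteq> set (replicate m Leaf)"
      "set zs \<subseteq> set (replicate m Leaf)"
      unfolding * by auto
    then have "xs = replicate (length xs) Leaf" "ys = replicate (length ys) Leaf"
      "zs = replicate (length zs) Leaf"
      by - (rule Leaf, assumption)+
    moreover have "m = length xs + length ys + length zs"
      using arg_cong[OF *, of length] by simp
    ultimately have ?JK
      using two_colored_above
      by (intro exI[of _ "length ys"] exI[of _ "length xs + 1 + length zs"] exI[of _ "length xs + 1"])
         (auto simp: label_JK_def)
    then show ?thesis ..
  next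
    case (two_colored_below yss)
    have *: "replicate m Leaf = concat yss"
      using two_colored_below by simp
    have "ys = replicate (length ys) Leaf" if "ys \<in> set yss" for ys
      using that by (intro Leaf) (auto simp: * )
    then have "map TwoColored yss = map corolla (map length yss)"
      by (auto simp: corolla_def)
    moreover have "sum_list (map length yss) = m"
      by (metis * length_concat length_replicate)
    ultimately have ?KJ
      using two_colored_below
      by (intro exI[of _ "map length yss"]) (auto simp: label_KJ_def Suc_le_eq)
    then show ?thesis ..
  next
    case (two_colored_subtree s s' xs zs)
    then have "s \<in> set (replicate m Leaf)"
      by simp
    then have "s = Leaf"
      by (simp split: if_splits)
    with \<open>blue_blow_up s s'\<close> show ?thesis
      by (auto elim: blue_blow_up.cases)
  qed
next
  assume ?JK
  then obtain h k i where t: "t = label_JK k i h" and "h + k = m + 1" "1 \<le> i" "i \<le> k" "2 \<le> h"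
    by blast
  then have "m = (i - 1) + (h + (k - i))"
    by simp
  then have "corolla m = TwoColored (replicate (i - 1) Leaf @ replicate h Leaf @ replicate (k - i) Leaf)"
    by (simp add: corolla_def replicate_add)
  then show ?L
    unfolding t label_JK_def using two_colored_above[of "replicate h Leaf"] \<open>2 \<le> h\<close> by simp
next
  assume ?KJ
  then obtain js where t: "t = label_KJ js" and js: "2 \<le> length js" "\<forall>j\<in>set js. 1 \<le> j" "sum_list js = m"
    by blast
  define yss where "yss = map (\<lambda>j. replicate j Leaf) js"
  have "concat (map (\<lambda>j. replicate j Leaf) js) = replicate (sum_list js) Leaf"
    by (induction js) (auto simp: replicate_add)
  then have "concat yss = replicate m Leaf"
    using js by (simp add: yss_def)
  moreover have "map TwoColored yss = map corolla js"
    by (simp add: yss_def corolla_def)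
  moreover have "blow_up (TwoColored (concat yss)) (Red (map TwoColored yss))"
    using js by (intro two_colored_below) (auto simp: yss_def)
  ultimately show ?L
    by (simp only: t label_KJ_def corolla_def[of m])
qed

section \<open>The cells of the \<open>n\<close>-multiplihedron\<close>

lemma multiplihedron_faces:
  assumes "multiplihedron m J \<phi>"
  shows "polytope J" "aff_dim J = int m - 1"
    and "bij_betw \<phi> {t. (blow_up ^^ i) (corolla m) t}
           {F. F face_of J \<and> F \<noteq> {} \<and> aff_dim F = int m - 1 - int i}"
  using assms[unfolded multiplihedron_def, THEN conjunct1]
    assms[unfolded multiplihedron_def, THEN conjunct2, THEN conjunct1]
    assms[unfolded multiplihedron_def, THEN conjunct2, THEN conjunct2, THEN conjunct1, THEN spec,
      of i]
  by - assumption+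

lemma multiplihedron_corolla:
  assumes "1 \<le> m" "multiplihedron m J \<phi>"
  shows "\<phi> (corolla m) = J"
proof -
  note J = multiplihedron_faces[OF assms(2)]
  have "J \<in> {F. F face_of J \<and> F \<noteq> {} \<and> aff_dim F = int m - 1 - int 0}"
    using J(1,2) assms(1) by (auto simp: face_of_refl polytope_imp_convex)
  then have "J \<in> \<phi> ` {t. (blow_up ^^ 0) (corolla m) t}"
    unfolding bij_betw_imp_surj_on[OF J(3)] .
  then show ?thesis
    by auto
qed

lemma rel_frontier_multiplihedron:
  assumes "multiplihedron m J \<phi>"
  shows "rel_frontier J = \<Union> (\<phi> ` {t. blow_up (corolla m) t})"
proof -
  note J = multiplihedron_faces[OF assms]
  have "{F. F facet_of J} = \<phi> ` {t. blow_up (corolla m) t}"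
    using J(3)[of 1] J(2) by (simp add: bij_betw_def facet_of_def eq_OO)
  then show ?thesis
    using rel_frontier_of_polyhedron[OF polytope_imp_polyhedron[OF J(1)]] by simp
qed

text \<open>
  The dimension of a product cell is at most \<open>n\<close> plus the dimension of the face of \<open>J\<close>, which drops
  by one with each blow-up. Equality forces the label to be the corolla; then the other factor is
  a face of \<open>\<Delta>\<^sup>n\<close> of full dimension.
\<close>

lemma top_cell_iff:
  assumes "1 \<le> m" "coordinate_frame b n" "multiplihedron m J \<phi>"
  shows "top_cell b n m \<phi> c \<longleftrightarrow> c = std_simplex b n \<times> J"
proof
  let ?S = "std_simplex b n"
  have J: "aff_dim J = int m - 1"
    by (rule multiplihedron_faces(2)[OF assms(3)])
  have S: "aff_dim ?S = int n"
    by (rule aff_dim_std_simplex[OF assms(2)])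
  have corolla: "\<phi> (corolla m) = J" "corolla m \<in> broken_trees m"
    using multiplihedron_corolla[OF assms(1,3)] by (simp_all add: broken_trees_def)
  {
    assume "c = ?S \<times> J"
    moreover have "?S \<noteq> {}" "J \<noteq> {}"
      using S J assms(1) by auto
    moreover from this have "?S \<in> subdivided_simplex b n (thresholds m (leaves_above (corolla m)))"
      by (simp add: leaves_above_corolla subdivided_simplex_Nil face_of_refl convex_std_simplex)
    then have "?S \<times> J \<in> n_multiplihedron b n m \<phi>"
      unfolding n_multiplihedron_def using corolla by blast
    ultimately show "top_cell b n m \<phi> c"
      using S J by (simp add: top_cell_def aff_dim_Times)
  }
  assume "top_cell b n m \<phi> c"
  then obtain C t where c: "c = C \<times> \<phi> t" and t: "t \<in> broken_trees m"
    and C: "C \<in> subdivided_simplex b n (thresholds m (leaves_above t))"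
    and dim: "aff_dim (C \<times> \<phi> t) = int n + int m - 1"
    by (auto simp: top_cell_def n_multiplihedron_def)
  obtain i where i: "(blow_up ^^ i) (corolla m) t"
    using t rtranclp_imp_relpowp[of blow_up "corolla m" t] by (auto simp: broken_trees_def)
  have "\<phi> t \<in> {F. F face_of J \<and> F \<noteq> {} \<and> aff_dim F = int m - 1 - int i}"
    using bij_betwE[OF multiplihedron_faces(3)[OF assms(3)]] i by blast
  then have "\<phi> t \<noteq> {}" "aff_dim (\<phi> t) = int m - 1 - int i"
    by auto
  moreover have "C \<noteq> {}" "aff_dim C \<le> int n"
    using subdivided_simplex_nonempty[OF C] aff_dim_subset[OF subdivided_simplex_subset[OF C]] S
    by auto
  ultimately have "i = 0" "aff_dim C = int n"
    using dim by (auto simp: aff_dim_Times)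
  then have "t = corolla m"
    using i by simp
  moreover from this have "C face_of ?S"
    using C by (simp add: leaves_above_corolla subdivided_simplex_Nil)
  then have "C = ?S"
    using face_of_aff_dim_lt[OF convex_std_simplex, of C b n] S \<open>aff_dim C = int n\<close> by auto
  ultimately show "c = ?S \<times> J"
    using c corolla by simp
qed

lemma boundary_cells:
  assumes "1 \<le> m" "coordinate_frame b n" "multiplihedron m J \<phi>"
  shows "sing_cells b n J \<union> JK_cells b n m \<phi> \<union> KJ_cells b n m \<phi> \<subseteq> n_multiplihedron b n m \<phi>"
proof -
  let ?S = "std_simplex b n"
  have facet: "t \<in> broken_trees m" if "blow_up (corolla m) t" for t
    using that by (auto simp: broken_trees_def)
  have "sing_cells b n J \<subseteq> n_multiplihedron b n m \<phi>"
  proof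
    fix c assume "c \<in> sing_cells b n J"
    then obtain I where "c = I \<times> \<phi> (corolla m)" "I facet_of ?S"
      using multiplihedron_corolla[OF assms(1,3)] by (auto simp: sing_cells_def)
    moreover have "corolla m \<in> broken_trees m"
      by (simp add: broken_trees_def)
    ultimately show "c \<in> n_multiplihedron b n m \<phi>"
      unfolding n_multiplihedron_def
      by (force simp: leaves_above_corolla subdivided_simplex_Nil facet_of_def)
  qed
  moreover have "JK_cells b n m \<phi> \<subseteq> n_multiplihedron b n m \<phi>"
  proof
    fix c assume "c \<in> JK_cells b n m \<phi>"
    then obtain h k i where c: "c = ?S \<times> \<phi> (label_JK k i h)"
      and hki: "h + k = m + 1" "1 \<le> i" "i \<le> k" "2 \<le> h"
      by (auto simp: JK_cells_def)
    have "label_JK k i h \<in> broken_trees m"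
      using hki by (intro facet) (auto simp: blow_up_corolla_iff)
    moreover have "?S \<in> subdivided_simplex b n (thresholds m (leaves_above (label_JK k i h)))"
      using hki aff_dim_std_simplex[OF assms(2)] face_of_refl[OF convex_std_simplex, of b n]
      by (auto simp: leaves_above_label_JK subdivided_simplex_Nil)
    ultimately show "c \<in> n_multiplihedron b n m \<phi>"
      unfolding n_multiplihedron_def c by blast
  qed
  moreover have "KJ_cells b n m \<phi> \<subseteq> n_multiplihedron b n m \<phi>"
  proof
    fix c assume "c \<in> KJ_cells b n m \<phi>"
    then obtain js Is where
      c: "c = labeled_cell b n (thresholds m (leaves_above (label_KJ js))) Is \<times> \<phi> (label_KJ js)"
      and js: "2 \<le> length js" "\<forall>j\<in>set js. 1 \<le> j" "sum_list js = m"
      and Is: "length Is = length js" "overlapping_partition n Is"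
      by (auto simp: KJ_cells_def)
    have "label_KJ js \<in> broken_trees m"
      using js by (intro facet) (auto simp: blow_up_corolla_iff)
    moreover have "length (thresholds m js) < length Is"
      using js Is by simp
    then have "labeled_cell b n (thresholds m (leaves_above (label_KJ js))) Is
        \<in> subdivided_simplex b n (thresholds m (leaves_above (label_KJ js)))"
      unfolding leaves_above_label_KJ
      using labeled_cell_in_subdivided_simplex[OF assms(2) thresholds_decreasing[OF js(2,3)] Is(2)] by blast
    ultimately show "c \<in> n_multiplihedron b n m \<phi>"
      unfolding n_multiplihedron_def c by blast
  qed
  ultimately show ?thesis
    by blast
qed

lemma Union_KJ_cells:
  "\<Union> (KJ_cells b n m \<phi>) = std_simplex b n \<times>
     \<Union> (\<phi> ` {label_KJ js | js. 2 \<le> length js \<and> (\<forall>j\<in>set js. 1 \<le> j) \<and> sum_list js = m})"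
proof (intro equalityI subsetI)
  fix zx assume "zx \<in> \<Union> (KJ_cells b n m \<phi>)"
  then show "zx \<in> std_simplex b n \<times>
     \<Union> (\<phi> ` {label_KJ js | js. 2 \<le> length js \<and> (\<forall>j\<in>set js. 1 \<le> j) \<and> sum_list js = m})"
    unfolding KJ_cells_def labeled_cell_def by blast
next
  fix zx assume "zx \<in> std_simplex b n \<times>
     \<Union> (\<phi> ` {label_KJ js | js. 2 \<le> length js \<and> (\<forall>j\<in>set js. 1 \<le> j) \<and> sum_list js = m})"
  then obtain z x js where zx: "zx = (z, x)" and z: "z \<in> std_simplex b n"
    and x: "x \<in> \<phi> (label_KJ js)"
    and js: "2 \<le> length js" "\<forall>j\<in>set js. 1 \<le> j" "sum_list js = m"
    by blast
  obtain Is where "overlapping_partition n Is" "length Is = length js"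
    "z \<in> labeled_cell b n (thresholds m js) Is"
    using labeled_cells_cover[OF z thresholds_decreasing[OF js(2,3)]] js(1) by auto
  then have "labeled_cell b n (thresholds m (leaves_above (label_KJ js))) Is \<times> \<phi> (label_KJ js)
      \<in> KJ_cells b n m \<phi>"
    unfolding KJ_cells_def using js by blast
  then show "zx \<in> \<Union> (KJ_cells b n m \<phi>)"
    using x zx \<open>z \<in> labeled_cell b n (thresholds m js) Is\<close>
    by (auto simp: leaves_above_label_KJ intro: UnionI)
qed

theorem proposition8:
  fixes b :: "nat \<Rightarrow> 'a::euclidean_space"
    and J :: "('b::euclidean_space) set"
    and \<phi> :: "broken_tree \<Rightarrow> 'b set"
    and n m :: nat
  assumes "1 \<le> m"
    and "coordinate_frame b n"
    and "multiplihedron m J \<phi>"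
  shows "(\<exists>!c. top_cell b n m \<phi> c) \<and>
         sing_cells b n J \<union> JK_cells b n m \<phi> \<union> KJ_cells b n m \<phi> \<subseteq> n_multiplihedron b n m \<phi> \<and>
         (\<forall>c. top_cell b n m \<phi> c \<longrightarrow>
            rel_frontier c = \<Union>(sing_cells b n J) \<union> \<Union>(JK_cells b n m \<phi>) \<union> \<Union>(KJ_cells b n m \<phi>))"
proof -
  let ?S = "std_simplex b n"
  let ?JK = "{label_JK k i h | h k i. h + k = m + 1 \<and> 1 \<le> i \<and> i \<le> k \<and> 2 \<le> h}"
  let ?KJ = "{label_KJ js | js. 2 \<le> length js \<and> (\<forall>j\<in>set js. 1 \<le> j) \<and> sum_list js = m}"
  have "polytope J"
    by (rule multiplihedron_faces(1)[OF assms(3)])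
  then have "rel_frontier (?S \<times> J) = rel_frontier ?S \<times> J \<union> ?S \<times> rel_frontier J"
    by (intro rel_frontier_Times)
       (auto simp: convex_std_simplex closed_std_simplex polytope_imp_convex polytope_imp_closed)
  also have "rel_frontier ?S \<times> J = \<Union> (sing_cells b n J)"
    unfolding rel_frontier_of_polyhedron[OF polyhedron_std_simplex] sing_cells_def by blast
  also have "rel_frontier J = \<Union> (\<phi> ` ?JK) \<union> \<Union> (\<phi> ` ?KJ)"
    unfolding rel_frontier_multiplihedron[OF assms(3)] blow_up_corolla_iff by blast
  also have "?S \<times> (\<Union> (\<phi> ` ?JK) \<union> \<Union> (\<phi> ` ?KJ)) = \<Union> (JK_cells b n m \<phi>) \<union> \<Union> (KJ_cells b n m \<phi>)"
    unfolding Union_KJ_cells JK_cells_def by blast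
  finally show ?thesis
    using boundary_cells[OF assms] by (simp add: top_cell_iff[OF assms] Un_assoc)
qed

end
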